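(* Let $N\ge 1$ be an integer and let $W=A_1(x)T^{+}+A_2(x)T^{-}+A_0(x)\mathcal I$ be a second order difference operator on the uniform grid $\{0,1,\dots,N\}$. The following are equivalent. (a) For every $n=0,1,\dots,N$, $W$ sends every polynomial in $x$ of degree at most $n$ (viewed as a function on the grid) to a polynomial of degree at most $n+1$ (viewed as a function on the grid). (b) There exist constants $\kappa,\mu_0,\mu_1,\nu_0,\nu_1,r_0,r_1\in\mathbb C$ such that for all $x\in\{0,1,\dots,N\}$ $$A_1(x)=(x-N)(\kappa x^2+\mu_1x+\mu_0),\qquad A_2(x)=x(\kappa x^2+\nu_1x+\nu_0),\qquad A_0(x)=-A_1(x)-A_2(x)+r_1x+r_0 .$$
   Context: Functions on the grid are complex-valued functions $f:\{0,1,\dots,N\}\to\mathbb C$. The shift operators are $T^{\pm}f(x)=f(x\pm1)$ and $\mathcal I$ is the identity. A second order difference operator on the grid is an operator $(Wf)(x)=A_1(x)f(x+1)+A_2(x)f(x-1)+A_0(x)f(x)$, $x\in\{0,\dots,N\}$, where $A_0,A_1,A_2$ are functions on the grid with $A_1(N)=0$ and $A_2(0)=0$ (so that values off the grid are never used: the terms with $f(N+1)$ and $f(-1)$ are understood to be $0$). A function on the grid is said to be a polynomial of degree at most $d$ if it is the restriction to the grid of such a polynomial. *)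

theory Defs
  imports Complex_Main "HOL-Computational_Algebra.Polynomial"
begin

text \<open>
  A function on the grid \<open>{0,\<dots>,N}\<close> is represented by a function of type
  \<^typ>\<open>nat \<Rightarrow> complex\<close>, only its values at arguments \<open>\<le> N\<close> being relevant.
  The conditionals make the terms with \<open>f (N + 1)\<close> and \<open>f (- 1)\<close> zero, so
  values off the grid (and truncated subtraction) never enter.
\<close>

definition diff_op ::
  "nat \<Rightarrow> (nat \<Rightarrow> complex) \<Rightarrow> (nat \<Rightarrow> complex) \<Rightarrow> (nat \<Rightarrow> complex)
    \<Rightarrow> (nat \<Rightarrow> complex) \<Rightarrow> (nat \<Rightarrow> complex)" where
  "diff_op N A1 A2 A0 f = (\<lambda>x.
      (if x < N then A1 x * f (x + 1) else 0)
    + (if 0 < x then A2 x * f (x - 1) else 0)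
    + A0 x * f x)"

definition grid_poly :: "nat \<Rightarrow> nat \<Rightarrow> (nat \<Rightarrow> complex) \<Rightarrow> bool" where
  "grid_poly N d f \<longleftrightarrow>
     (\<exists>p :: complex poly. degree p \<le> d \<and> (\<forall>x\<in>{0..N}. f x = poly p (of_nat x)))"

end

theory Submission
  imports Defs
begin

text \<open>
  Evaluating \<open>W\<close> on \<open>1, x, x\<^sup>2\<close> shows that, on the grid, \<open>A\<^sub>1 + A\<^sub>2 + A\<^sub>0\<close>, \<open>A\<^sub>1 - A\<^sub>2\<close> and \<open>A\<^sub>1 + A\<^sub>2\<close>
  are polynomials of degree at most 1, 2 and 3. Hence \<open>A\<^sub>1\<close> and \<open>A\<^sub>2\<close> are cubic with a common
  leading coefficient, and the boundary conditions supply the factors \<open>x - N\<close> and \<open>x\<close>. Conversely,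
  \<open>W p\<close> is \<open>\<kappa> x\<^sup>3\<close> times a second difference of \<open>p\<close>, plus quadratic polynomials times
  first differences of \<open>p\<close>, plus \<open>(r\<^sub>1 x + r\<^sub>0) p\<close>; each difference lowers the degree by one.
\<close>

text \<open>A shift of the argument keeps both the degree and the leading coefficient, so the top
  terms cancel. The zero case stands apart because for constant \<open>p\<close> no degree lies
  below \<open>degree p\<close>.\<close>

lemma shift_diff_degree_less:
  fixes p :: "complex poly"
  shows "p \<circ>\<^sub>p [:c, 1:] - p = 0 \<or> degree (p \<circ>\<^sub>p [:c, 1:] - p) < degree p"
proof (rule eq_zero_or_degree_less)
  show "degree (p \<circ>\<^sub>p [:c, 1:] - p) \<le> degree p"
    by (rule degree_diff_le) (simp_all add: degree_pcompose)
  have "coeff (p \<circ>\<^sub>p [:c, 1:]) (degree p) = lead_coeff (p \<circ>\<^sub>p [:c, 1:])"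
    by (simp add: degree_pcompose)
  also have "\<dots> = lead_coeff p"
    by (subst lead_coeff_comp) simp_all
  finally show "coeff (p \<circ>\<^sub>p [:c, 1:] - p) (degree p) = 0" by simp
qed

lemma degree_mult_shift_diff_le:
  fixes p q :: "complex poly"
  assumes "degree q \<le> Suc d"
  shows "degree (q * (p \<circ>\<^sub>p [:c, 1:] - p)) \<le> degree p + d"
  using shift_diff_degree_less[of p c] assms
    degree_mult_le[of q "p \<circ>\<^sub>p [:c, 1:] - p"] by auto

text \<open>Up to sign, the second difference is the forward difference of the backward difference
  of \<open>p\<close>, so the degree drops twice.\<close>

lemma degree_mult_second_diff_le:
  fixes p q :: "complex poly"
  assumes "degree q \<le> Suc (Suc d)"
  shows "degree (q * ((p \<circ>\<^sub>p [:1, 1:] - p) + (p \<circ>\<^sub>p [:-1, 1:] - p))) \<le> degree p + d"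
proof -
  let ?u = "p \<circ>\<^sub>p [:-1, 1:] - p"
  have "p \<circ>\<^sub>p [:-1, 1:] \<circ>\<^sub>p [:1, 1:] = p"
    by (simp add: pcompose_assoc[symmetric] pcompose_pCons)
  then have eq: "(p \<circ>\<^sub>p [:1, 1:] - p) + ?u = - (?u \<circ>\<^sub>p [:1, 1:] - ?u)"
    by (simp add: pcompose_diff)
  show ?thesis
  proof (cases "?u = 0")
    case True
    then show ?thesis using eq by simp
  next
    case False
    then have "degree ?u < degree p"
      using shift_diff_degree_less[of p "-1"] by blast
    with degree_mult_shift_diff_le[OF assms, of ?u 1]
    have "degree (q * (?u \<circ>\<^sub>p [:1, 1:] - ?u)) \<le> degree p + d" by linarith
    then show ?thesis unfolding eq by (simp only: mult_minus_right degree_minus)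
  qed
qed

lemma poly_degree_le_2:
  fixes p :: "complex poly"
  assumes "degree p \<le> 2"
  shows "poly p x = coeff p 2 * x ^ 2 + coeff p 1 * x + coeff p 0"
proof -
  have "(\<Sum>i\<le>degree p. coeff p i * x ^ i) = (\<Sum>i\<le>2. coeff p i * x ^ i)"
    using assms by (intro sum.mono_neutral_left) (auto simp: coeff_eq_0)
  then show ?thesis by (simp add: poly_altdef numeral_2_eq_2 algebra_simps)
qed

text \<open>Division by \<open>x - a\<close> leaves a quadratic quotient. Its top coefficient is
  kept as \<open>coeff p 3\<close>, so that the values for two cubics can be compared later.\<close>

lemma poly_degree_le_3_root:
  fixes p :: "complex poly"
  assumes "degree p \<le> 3" and "poly p a = 0"
  obtains m\<^sub>0 m\<^sub>1 where "\<And>x. poly p x = (x - a) * (coeff p 3 * x ^ 2 + m\<^sub>1 * x + m\<^sub>0)"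
proof -
  obtain q where q: "p = [:-a, 1:] * q"
    using assms(2) by (auto simp: poly_eq_0_iff_dvd)
  have dq: "degree q \<le> 2"
    using assms(1) q degree_mult_eq[of "[:-a, 1:]" q] by (cases "q = 0") auto
  have "coeff p 3 = coeff q 2"
    using dq coeff_eq_0[of q 3] by (simp add: q numeral_3_eq_3 numeral_2_eq_2)
  then have "poly p x = (x - a) * (coeff p 3 * x ^ 2 + coeff q 1 * x + coeff q 0)" for x
    using poly_degree_le_2[OF dq, of x] by (simp only: q poly_mult) simp
  then show thesis by (rule that)
qed

text \<open>Where a conditional cuts off a neighbour, the coefficient in front is zero, so the
  polynomial may be evaluated at -1 and \<open>N + 1\<close> without harm.\<close>

lemma diff_op_on_grid:
  assumes "A1 N = 0" "A2 0 = 0" "x \<in> {0..N}"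
  shows "diff_op N A1 A2 A0 (\<lambda>y. poly p (of_nat y)) x =
    A1 x * poly p (of_nat x + 1) + A2 x * poly p (of_nat x - 1) + A0 x * poly p (of_nat x)"
proof -
  have "x = N \<or> x < N" using assms(3) by auto
  then show ?thesis
    using assms(1,2) by (auto simp: diff_op_def of_nat_diff add.commute)
qed

lemma diff_op_cong_grid:
  assumes "\<And>y. y \<in> {0..N} \<Longrightarrow> f y = g y" "x \<in> {0..N}"
  shows "diff_op N A1 A2 A0 f x = diff_op N A1 A2 A0 g x"
  using assms by (auto simp: diff_op_def)

lemma diff_op_raises_degree_at_most_one:
  fixes A1 A2 A0 :: "nat \<Rightarrow> complex"
  assumes "A1 N = 0" and "A2 0 = 0" and f: "grid_poly N n f"
    and A: "\<And>x. x \<in> {0..N} \<Longrightarrow>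
        A1 x = (of_nat x - of_nat N) * (k * of_nat x ^ 2 + m1 * of_nat x + m0)
      \<and> A2 x = of_nat x * (k * of_nat x ^ 2 + n1 * of_nat x + n0)
      \<and> A0 x = - A1 x - A2 x + r1 * of_nat x + r0"
  shows "grid_poly N (n + 1) (diff_op N A1 A2 A0 f)"
proof -
  obtain p where p: "degree p \<le> n" "\<And>x. x \<in> {0..N} \<Longrightarrow> f x = poly p (of_nat x)"
    using f unfolding grid_poly_def by blast
  let ?N = "of_nat N :: complex"
  let ?u = "p \<circ>\<^sub>p [:1, 1:] - p" and ?v = "p \<circ>\<^sub>p [:-1, 1:] - p"
  \<comment> \<open>These are what remains of the two cubics for \<open>A1\<close> and
    \<open>A2\<close> after the common term \<open>k * x^3\<close> is split off.\<close>
  let ?P = "[:- ?N * m0, m0 - ?N * m1, m1 - ?N * k:]" and ?Q = "[:0, n0, n1:]"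
  define R where "R = [:0, 0, 0, k:] * (?u + ?v) + ?P * ?u + ?Q * ?v + [:r0, r1:] * p"
  have "degree ([:0, 0, 0, k:] * (?u + ?v)) \<le> degree p + 1"
    by (rule degree_mult_second_diff_le) simp
  moreover have "degree (?P * ?u) \<le> degree p + 1" "degree (?Q * ?v) \<le> degree p + 1"
    by (rule degree_mult_shift_diff_le, simp)+
  moreover have "degree ([:r0, r1:] * p) \<le> degree p + 1"
    using degree_mult_le[of "[:r0, r1:]" p] by (auto split: if_splits)
  ultimately have "degree R \<le> degree p + 1"
    unfolding R_def by (intro degree_add_le)
  then have "degree R \<le> n + 1" using p(1) by simp
  moreover have "diff_op N A1 A2 A0 f x = poly R (of_nat x)" if x: "x \<in> {0..N}" for x
  proof -
    from A[OF x] have a1: "A1 x = (of_nat x - of_nat N) * (k * of_nat x ^ 2 + m1 * of_nat x + m0)"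
      and a2: "A2 x = of_nat x * (k * of_nat x ^ 2 + n1 * of_nat x + n0)"
      and a0: "A0 x = - A1 x - A2 x + r1 * of_nat x + r0"
      by blast+
    have shift: "poly (p \<circ>\<^sub>p [:1, 1:]) (of_nat x) = poly p (of_nat x + 1)"
      "poly (p \<circ>\<^sub>p [:-1, 1:]) (of_nat x) = poly p (of_nat x - 1)"
      by (simp_all add: poly_pcompose add.commute)
    have "diff_op N A1 A2 A0 f x =
        A1 x * poly p (of_nat x + 1) + A2 x * poly p (of_nat x - 1) + A0 x * poly p (of_nat x)"
      using diff_op_cong_grid[OF p(2) x] diff_op_on_grid[of A1 N A2 x, OF assms(1,2) x] by simp
    \<comment> \<open>Eliminating \<open>A0\<close> leaves first differences of \<open>p\<close>;
      the shared cubic term then multiplies their sum, a second difference.\<close>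
    also have "\<dots> = A1 x * (poly p (of_nat x + 1) - poly p (of_nat x))
        + A2 x * (poly p (of_nat x - 1) - poly p (of_nat x))
        + (r1 * of_nat x + r0) * poly p (of_nat x)"
      unfolding a0 by (simp add: algebra_simps)
    also have "\<dots> = poly R (of_nat x)"
      unfolding a1 a2
      by (simp add: R_def shift) (simp add: algebra_simps power2_eq_square)
    finally show ?thesis .
  qed
  ultimately show ?thesis unfolding grid_poly_def by blast
qed

lemma diff_op_coefficients:
  fixes A1 A2 A0 :: "nat \<Rightarrow> complex"
  assumes "N \<ge> 1" and "A1 N = 0" and "A2 0 = 0"
    and W: "\<And>n f. n \<in> {0..N} \<Longrightarrow> grid_poly N n f \<Longrightarrow> grid_poly N (n + 1) (diff_op N A1 A2 A0 f)"
  obtains k m0 m1 n0 n1 r0 r1 where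
    "\<And>x. x \<in> {0..N} \<Longrightarrow>
        A1 x = (of_nat x - of_nat N) * (k * of_nat x ^ 2 + m1 * of_nat x + m0)
      \<and> A2 x = of_nat x * (k * of_nat x ^ 2 + n1 * of_nat x + n0)
      \<and> A0 x = - A1 x - A2 x + r1 * of_nat x + r0"
proof -
  have W': "\<exists>q. degree q \<le> n + 1 \<and> (\<forall>x\<in>{0..N}. A1 x * poly p (of_nat x + 1)
      + A2 x * poly p (of_nat x - 1) + A0 x * poly p (of_nat x) = poly q (of_nat x))"
    if "n \<in> {0..N}" "grid_poly N n (\<lambda>y. poly p (of_nat y))" for n p
    using W[OF that] diff_op_on_grid[of A1 N A2 _ A0 p, OF assms(2,3)]
    unfolding grid_poly_def by auto
  have "grid_poly N 0 (\<lambda>y. poly 1 (of_nat y))"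
    unfolding grid_poly_def by (intro exI[of _ 1]) simp
  from W'[OF _ this] obtain p0 where p0: "degree p0 \<le> 1"
    "\<And>x. x \<in> {0..N} \<Longrightarrow> A1 x + A2 x + A0 x = poly p0 (of_nat x)"
    by auto
  have "grid_poly N 1 (\<lambda>y. poly [:0, 1:] (of_nat y))"
    unfolding grid_poly_def by (intro exI[of _ "[:0, 1:]"]) simp
  from W'[OF _ this] obtain p1 where p1: "degree p1 \<le> 2"
    "\<And>x. x \<in> {0..N} \<Longrightarrow> A1 x * (of_nat x + 1) + A2 x * (of_nat x - 1) + A0 x * of_nat x
      = poly p1 (of_nat x)"
    using assms(1) by (auto simp: numeral_2_eq_2)
  \<comment> \<open>For \<open>N = 1\<close> hypothesis \<open>W\<close> is unavailable for \<open>n = 2\<close>, but then \<open>x\<^sup>2 = x\<close> on the grid.\<close>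
  have "grid_poly N (min 2 N) (\<lambda>y. poly [:0, 0, 1:] (of_nat y))"
  proof (cases "N = 1")
    case True
    have "y = 0 \<or> y = 1" if "y \<in> {0..1}" for y :: nat using that by auto
    then show ?thesis
      unfolding grid_poly_def True by (intro exI[of _ "[:0, 1:]"]) fastforce
  next
    case False
    then show ?thesis
      using assms(1) unfolding grid_poly_def by (intro exI[of _ "[:0, 0, 1:]"]) simp
  qed
  from W'[OF _ this] obtain p2 where "degree p2 \<le> min 2 N + 1"
    and p2_eq: "\<forall>x\<in>{0..N}. A1 x * poly [:0, 0, 1:] (of_nat x + 1)
      + A2 x * poly [:0, 0, 1:] (of_nat x - 1) + A0 x * poly [:0, 0, 1:] (of_nat x)
      = poly p2 (of_nat x)"
    by auto
  then have p2: "degree p2 \<le> 3"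
    "\<And>x. x \<in> {0..N} \<Longrightarrow> A1 x * (of_nat x + 1)^2 + A2 x * (of_nat x - 1)^2 + A0 x * of_nat x ^ 2
      = poly p2 (of_nat x)"
    by (simp_all add: power2_eq_square)
  \<comment> \<open>Expanding (x + 1)^2 and (x - 1)^2 gives W x^2 = x^2
    (\<open>A1 + A2 + A0\<close>) + 2x (\<open>A1 - A2\<close>) + (\<open>A1 + A2\<close>), and
    likewise W x = x (\<open>A1 + A2 + A0\<close>) + (\<open>A1 - A2\<close>). Subtracting the known
    terms isolates \<open>A1 - A2\<close> as \<open>q\<close> and \<open>A1 + A2\<close> as
    \<open>s\<close>.\<close>
  define q where "q = p1 - [:0, 1:] * p0"
  define s where "s = p2 - [:0, 2:] * q - [:0, 0, 1:] * p0"
  have q_deg: "degree q \<le> 2"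
    unfolding q_def using p1(1) p0(1) degree_mult_le[of "[:0, 1:]" p0]
    by (intro degree_diff_le) auto
  have s_deg: "degree s \<le> 3"
    unfolding s_def using p2(1) p0(1) q_deg degree_mult_le[of "[:0, 2:]" q]
      degree_mult_le[of "[:0, 0, 1:]" p0]
    by (intro degree_diff_le) auto
  have q_eq: "poly q (of_nat x) = A1 x - A2 x" if "x \<in> {0..N}" for x
    using p0(2)[OF that, symmetric] p1(2)[OF that, symmetric]
    by (simp add: q_def algebra_simps)
  have s_eq: "poly s (of_nat x) = A1 x + A2 x" if "x \<in> {0..N}" for x
    unfolding s_def poly_diff poly_mult q_eq[OF that] p0(2)[OF that, symmetric]
      p2(2)[OF that, symmetric]
    by (simp add: algebra_simps power2_eq_square)
  define P where "P = smult (1/2) (s + q)"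
  define Q where "Q = smult (1/2) (s - q)"
  have P_eq: "poly P (of_nat x) = A1 x" and Q_eq: "poly Q (of_nat x) = A2 x"
    if "x \<in> {0..N}" for x
    using q_eq[OF that] s_eq[OF that] by (simp_all add: P_def Q_def field_simps)
  have "degree P \<le> 3" "degree Q \<le> 3"
    unfolding P_def Q_def using s_deg q_deg by (auto intro!: degree_add_le degree_diff_le)
  moreover have "poly P (of_nat N) = 0" "poly Q 0 = 0"
    using P_eq[of N] Q_eq[of 0] assms(2,3) by simp_all
  ultimately obtain m0 m1 n0 n1 where
    mn: "\<And>x. poly P x = (x - of_nat N) * (coeff P 3 * x ^ 2 + m1 * x + m0)"
      "\<And>x. poly Q x = (x - 0) * (coeff Q 3 * x ^ 2 + n1 * x + n0)"
    using poly_degree_le_3_root by metis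
  \<comment> \<open>\<open>P\<close> and \<open>Q\<close> differ by \<open>q\<close>, which has no
    cubic term; this is why a single \<kappa> serves both.\<close>
  have lc: "coeff Q 3 = coeff P 3"
    using q_deg coeff_eq_0[of q 3] by (simp add: P_def Q_def)
  have r: "poly p0 x = coeff p0 1 * x + coeff p0 0" for x
    using poly_degree_le_2[of p0 x] p0(1) coeff_eq_0[of p0 2] by simp
  show thesis
  \<comment> \<open>The witness for \<kappa> is the shared cubic coefficient; those for
    \<open>r1\<close> and \<open>r0\<close> are the coefficients of \<open>p0\<close>, which
    represents W 1.\<close>
  proof (rule that)
    fix x assume x: "x \<in> {0..N}"
    have "A0 x = - A1 x - A2 x + poly p0 (of_nat x)"
      using p0(2)[OF x, symmetric] by simp
    then show "A1 x = (of_nat x - of_nat N) * (coeff P 3 * of_nat x ^ 2 + m1 * of_nat x + m0)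
      \<and> A2 x = of_nat x * (coeff P 3 * of_nat x ^ 2 + n1 * of_nat x + n0)
      \<and> A0 x = - A1 x - A2 x + coeff p0 1 * of_nat x + coeff p0 0"
      using mn(1)[of "of_nat x"] mn(2)[of "of_nat x"] P_eq[OF x] Q_eq[OF x] lc r by simp
  qed
qed

theorem mainTheorem1:
  fixes N :: nat and A1 A2 A0 :: "nat \<Rightarrow> complex"
  assumes "N \<ge> 1" and "A1 N = 0" and "A2 0 = 0"
  shows "(\<forall>n\<in>{0..N}. \<forall>f. grid_poly N n f \<longrightarrow> grid_poly N (n + 1) (diff_op N A1 A2 A0 f))
    \<longleftrightarrow>
    (\<exists>\<kappa> \<mu>\<^sub>0 \<mu>\<^sub>1 \<nu>\<^sub>0 \<nu>\<^sub>1 r\<^sub>0 r\<^sub>1 :: complex. \<forall>x\<in>{0..N}.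
        A1 x = (of_nat x - of_nat N) * (\<kappa> * of_nat x ^ 2 + \<mu>\<^sub>1 * of_nat x + \<mu>\<^sub>0)
      \<and> A2 x = of_nat x * (\<kappa> * of_nat x ^ 2 + \<nu>\<^sub>1 * of_nat x + \<nu>\<^sub>0)
      \<and> A0 x = - A1 x - A2 x + r\<^sub>1 * of_nat x + r\<^sub>0)"
    (is "?a \<longleftrightarrow> ?b")
proof
  assume ?a
  then have "\<And>n f. n \<in> {0..N} \<Longrightarrow> grid_poly N n f \<Longrightarrow> grid_poly N (n + 1) (diff_op N A1 A2 A0 f)"
    by blast
  from diff_op_coefficients[OF assms this] show ?b by (metis (no_types, lifting))
next
  assume ?b
  then obtain k m0 m1 n0 n1 r0 r1 where "\<forall>x\<in>{0..N}.
        A1 x = (of_nat x - of_nat N) * (k * of_nat x ^ 2 + m1 * of_nat x + m0)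
      \<and> A2 x = of_nat x * (k * of_nat x ^ 2 + n1 * of_nat x + n0)
      \<and> A0 x = - A1 x - A2 x + r1 * of_nat x + r0"
    by blast
  then show ?a
    using diff_op_raises_degree_at_most_one[of A1 N A2, OF assms(2,3)] by blast
qed

end
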